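(* Let $T>0$, let $H$ be a real separable Hilbert space, $A\colon D(A)\subseteq H\to H$ the generator of a $C_0$-semigroup on $H$, $\rho,\beta\in\mathbb R$, $\psi\in D(A^* )$ an eigenvector of $A^*$ with eigenvalue $\lambda\in\mathbb R$, and $\phi\in H$ with $\langle\phi,\psi\rangle\neq0$. Put $\alpha:=\frac{-\rho+2\lambda+\beta^2}{\langle\phi,\psi\rangle^2}$, let $\Theta\colon\mathbb R\to\mathbb R$ be $\Theta(y)=1$ for $y\ge0$ and $\Theta(y)=0$ for $y<0$, and set $$F(s,x,p):=\inf_{a\in\mathbb R}\big\{\langle p,a\phi\rangle+e^{-\rho s}\Theta(\langle x,\psi\rangle)a^2\big\},\qquad (s,x,p)\in[0,T]\times H\times H.$$ Then the function $v\colon[0,T]\times H\to\mathbb R$, $$v(s,x)=\alpha e^{-\rho s}\,\Theta(\langle x,\psi\rangle)\,\langle x,\psi\rangle^2,$$ is a strong solution of the HJB equation $$\mathscr L_0(v)(s,x)=-F(s,x,\partial_xv(s,x)),\qquad v(T,x)=g(x):=e^{-\rho T}\alpha\,\Theta(\langle x,\psi\rangle)\langle x,\psi\rangle^2 .$$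
   Context: $A^*$ is the adjoint of $A$ and $D(A^* )$ carries the graph norm. Operator $\mathscr L_0$: $D(\mathscr L_0)=\{\varphi\in C^{1,2}([0,T]\times H):\partial_x\varphi\in C([0,T]\times H;D(A^* ))\}$ and $\mathscr L_0(\varphi)(s,x)=\partial_s\varphi(s,x)+\langle A^*\partial_x\varphi(s,x),x\rangle+\tfrac12\beta^2\langle x,\partial^2_{xx}\varphi(s,x)(x)\rangle$. Here $C^{1,2}$ means once continuously differentiable in time and twice continuously Fréchet differentiable in $x$; $\partial_x\varphi$ is identified with an element of $H$ and $\partial_{xx}^2\varphi$ with a symmetric bounded operator on $H$. Strong solution: $v\in C^{0,1}([0,T[\times H)\cap C^0([0,T]\times H)$ with $\partial_xv\in UC([0,T[\times H;D(A^* ))$ is a strong solution of $\mathscr L_0(v)(s,x)=-F(s,x,\partial_xv(s,x))$, $v(T,x)=g(x)$ (with $g\in C(H)$) if: (I) $(s,x)\mapsto F(s,x,\partial_xv(s,x))$ is finite and continuous on $[0,T[\times H$ and admits a continuous extension to $[0,T]\times H$; (II) there are sequences $\{v_n\}\subseteq D(\mathscr L_0)$, $\{h_n\}\subseteq C([0,T]\times H)$, $\{g_n\}\subseteq C(H)$ such that for each $n$, $\mathscr L_0(v_n)(s,x)=h_n(s,x)$ and $v_n(T,x)=g_n(x)$ for all $(s,x)\in[0,T]\times H$, and $v_n\to v$ in $C([0,T]\times H)$, $h_n\to-F(\cdot,\cdot,\partial_xv(\cdot,\cdot))$ in $C([0,T]\times H)$, $g_n\to g$ in $C(H)$, where these convergences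 are uniform on compact sets. Here $C^{0,1}$ denotes continuous functions that are Fréchet differentiable in $x$ with $\partial_x$ continuous in $(t,x)$, and $UC([0,T[\times H;D(A^* ))$ denotes functions $[0,T[\times H\to D(A^* )$ uniformly continuous on each ball of $[0,T[\times H$. *)

theory Defs
  imports "HOL-Analysis.Analysis"
begin

text \<open>
  An unbounded operator \<open>A : D(A) \<subseteq> H \<rightarrow> H\<close> is a pair of a set \<open>D\<close> and a total function \<open>A\<close>; only the
  values of \<open>A\<close> on \<open>D\<close> matter.  Functions on \<open>[0,T] \<times> H\<close> are curried functions on all of
  \<open>\<real> \<times> H\<close>; only their values for \<open>s \<in> [0,T]\<close> matter.
\<close>

subsection \<open>Semigroups, generators, adjoints\<close>

definition C0_semigroup :: "(real \<Rightarrow> 'h \<Rightarrow> 'h::real_normed_vector) \<Rightarrow> bool" where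
  "C0_semigroup S \<longleftrightarrow>
     (\<forall>t\<ge>0. bounded_linear (S t)) \<and>
     (\<forall>x. S 0 x = x) \<and>
     (\<forall>s\<ge>0. \<forall>t\<ge>0. \<forall>x. S (s + t) x = S s (S t x)) \<and>
     (\<forall>x. ((\<lambda>t. S t x) \<longlongrightarrow> x) (at_right 0))"

definition is_generator ::
    "(real \<Rightarrow> 'h \<Rightarrow> 'h::real_normed_vector) \<Rightarrow> 'h set \<Rightarrow> ('h \<Rightarrow> 'h) \<Rightarrow> bool" where
  "is_generator S D A \<longleftrightarrow>
     D = {x. \<exists>y. ((\<lambda>t. (S t x - x) /\<^sub>R t) \<longlongrightarrow> y) (at_right 0)} \<and>
     (\<forall>x\<in>D. ((\<lambda>t. (S t x - x) /\<^sub>R t) \<longlongrightarrow> A x) (at_right 0))"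

definition adj_dom :: "'h set \<Rightarrow> ('h \<Rightarrow> 'h) \<Rightarrow> 'h::real_inner set" where
  "adj_dom D A = {y. \<exists>z. \<forall>x\<in>D. inner (A x) y = inner x z}"

text \<open>The adjoint is well defined on its domain because the domain of a generator is dense.\<close>

definition adj_op :: "'h set \<Rightarrow> ('h \<Rightarrow> 'h) \<Rightarrow> 'h \<Rightarrow> 'h::real_inner" where
  "adj_op D A y = (THE z. \<forall>x\<in>D. inner (A x) y = inner x z)"

definition graph_norm :: "'h set \<Rightarrow> ('h \<Rightarrow> 'h) \<Rightarrow> 'h::real_inner \<Rightarrow> real" where
  "graph_norm D A y = norm y + norm (adj_op D A y)"

definition continuous_into_adj ::
    "'h set \<Rightarrow> ('h \<Rightarrow> 'h) \<Rightarrow> 'b::topological_space set \<Rightarrow> ('b \<Rightarrow> 'h::real_inner) \<Rightarrow> bool" where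
  "continuous_into_adj D A X f \<longleftrightarrow>
     (\<forall>p\<in>X. f p \<in> adj_dom D A) \<and>
     (\<forall>p\<in>X. ((\<lambda>q. graph_norm D A (f q - f p)) \<longlongrightarrow> 0) (at p within X))"

definition UC_into_adj ::
    "'h set \<Rightarrow> ('h \<Rightarrow> 'h) \<Rightarrow> 'b::metric_space set \<Rightarrow> ('b \<Rightarrow> 'h::real_inner) \<Rightarrow> bool" where
  "UC_into_adj D A X f \<longleftrightarrow>
     (\<forall>p\<in>X. f p \<in> adj_dom D A) \<and>
     (\<forall>c\<in>X. \<forall>r>0. \<forall>\<epsilon>>0. \<exists>\<delta>>0. \<forall>p \<in> X \<inter> ball c r. \<forall>q \<in> X \<inter> ball c r.
        dist p q < \<delta> \<longrightarrow> graph_norm D A (f p - f q) < \<epsilon>)"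

subsection \<open>Derivatives and function classes\<close>

text \<open>\<open>GDERIV f x :> D\<close> is Frechet differentiability with the derivative represented by the
  vector \<open>D\<close>; by the Riesz theorem this is no restriction in a Hilbert space.\<close>

definition grad :: "('h::real_inner \<Rightarrow> real) \<Rightarrow> 'h \<Rightarrow> 'h" where
  "grad f x = (THE D. GDERIV f x :> D)"

definition hessian :: "('h::real_inner \<Rightarrow> real) \<Rightarrow> 'h \<Rightarrow> 'h \<Rightarrow>\<^sub>L 'h" where
  "hessian f x = (THE L. (grad f has_derivative blinfun_apply L) (at x))"

text \<open>One-sided derivative at the endpoints of \<open>[0,T]\<close>.\<close>

definition time_deriv :: "real \<Rightarrow> (real \<Rightarrow> 'h \<Rightarrow> real) \<Rightarrow> real \<Rightarrow> 'h \<Rightarrow> real" where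
  "time_deriv T f s x = vector_derivative (\<lambda>r. f r x) (at s within {0..T})"

definition C01 :: "real set \<Rightarrow> (real \<Rightarrow> 'h::real_inner \<Rightarrow> real) \<Rightarrow> bool" where
  "C01 I f \<longleftrightarrow>
     continuous_on (I \<times> UNIV) (\<lambda>(s, x). f s x) \<and>
     (\<forall>s\<in>I. \<forall>x. \<exists>D. GDERIV (f s) x :> D) \<and>
     continuous_on (I \<times> UNIV) (\<lambda>(s, x). grad (f s) x)"

definition C12 :: "real \<Rightarrow> (real \<Rightarrow> 'h::real_inner \<Rightarrow> real) \<Rightarrow> bool" where
  "C12 T f \<longleftrightarrow>
     C01 {0..T} f \<and>
     (\<forall>s\<in>{0..T}. \<forall>x. (\<lambda>r. f r x) differentiable (at s within {0..T})) \<and>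
     continuous_on ({0..T} \<times> UNIV) (\<lambda>(s, x). time_deriv T f s x) \<and>
     (\<forall>s\<in>{0..T}. \<forall>x. grad (f s) differentiable (at x)) \<and>
     continuous_on ({0..T} \<times> UNIV) (\<lambda>(s, x). hessian (f s) x)"

subsection \<open>The operator and strong solutions\<close>

definition dom_L0 :: "real \<Rightarrow> 'h set \<Rightarrow> ('h \<Rightarrow> 'h) \<Rightarrow> (real \<Rightarrow> 'h::real_inner \<Rightarrow> real) set" where
  "dom_L0 T D A =
     {f. C12 T f \<and> continuous_into_adj D A ({0..T} \<times> UNIV) (\<lambda>(s, x). grad (f s) x)}"

definition L0 :: "real \<Rightarrow> 'h set \<Rightarrow> ('h \<Rightarrow> 'h) \<Rightarrow> real \<Rightarrow>
    (real \<Rightarrow> 'h::real_inner \<Rightarrow> real) \<Rightarrow> real \<Rightarrow> 'h \<Rightarrow> real" where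
  "L0 T D A \<beta> f s x =
     time_deriv T f s x + inner (adj_op D A (grad (f s) x)) x
       + 1/2 * \<beta>\<^sup>2 * inner x (blinfun_apply (hessian (f s) x) x)"

text \<open>
  The Hamiltonian \<open>F\<close> may take infinite values.  \<open>k\<close> is the continuous extension to
  \<open>[0,T] \<times> H\<close> of \<open>(s,x) \<mapsto> F s x (grad (v s) x)\<close>; it is unique when \<open>T > 0\<close>, so
  the convergence of \<open>h n\<close> to \<open>- k\<close> expresses the convergence to \<open>- F\<close>.
\<close>

definition strong_solution :: "real \<Rightarrow> 'h set \<Rightarrow> ('h \<Rightarrow> 'h) \<Rightarrow> real \<Rightarrow>
    (real \<Rightarrow> 'h \<Rightarrow> 'h \<Rightarrow> ereal) \<Rightarrow> ('h \<Rightarrow> real) \<Rightarrow> (real \<Rightarrow> 'h::real_inner \<Rightarrow> real) \<Rightarrow> bool" where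
  "strong_solution T D A \<beta> F g v \<longleftrightarrow>
     continuous_on UNIV g \<and>
     C01 {0..<T} v \<and>
     continuous_on ({0..T} \<times> UNIV) (\<lambda>(s, x). v s x) \<and>
     UC_into_adj D A ({0..<T} \<times> UNIV) (\<lambda>(s, x). grad (v s) x) \<and>
     (\<forall>s\<in>{0..<T}. \<forall>x. \<bar>F s x (grad (v s) x)\<bar> \<noteq> \<infinity>) \<and>
     continuous_on ({0..<T} \<times> UNIV) (\<lambda>(s, x). F s x (grad (v s) x)) \<and>
     (\<exists>k :: real \<Rightarrow> 'h \<Rightarrow> real.
        continuous_on ({0..T} \<times> UNIV) (\<lambda>(s, x). k s x) \<and>
        (\<forall>s\<in>{0..<T}. \<forall>x. F s x (grad (v s) x) = ereal (k s x)) \<and>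
        (\<exists>(vn :: nat \<Rightarrow> real \<Rightarrow> 'h \<Rightarrow> real) (hn :: nat \<Rightarrow> real \<Rightarrow> 'h \<Rightarrow> real) (gn :: nat \<Rightarrow> 'h \<Rightarrow> real).
           (\<forall>n. vn n \<in> dom_L0 T D A) \<and>
           (\<forall>n. continuous_on ({0..T} \<times> UNIV) (\<lambda>(s, x). hn n s x)) \<and>
           (\<forall>n. continuous_on UNIV (gn n)) \<and>
           (\<forall>n. \<forall>s\<in>{0..T}. \<forall>x. L0 T D A \<beta> (vn n) s x = hn n s x \<and> vn n T x = gn n x) \<and>
           (\<forall>K. compact K \<and> K \<subseteq> {0..T} \<times> UNIV \<longrightarrow>
              uniform_limit K (\<lambda>n (s, x). vn n s x) (\<lambda>(s, x). v s x) sequentially \<and>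
              uniform_limit K (\<lambda>n (s, x). hn n s x) (\<lambda>(s, x). - k s x) sequentially) \<and>
           (\<forall>K. compact K \<longrightarrow> uniform_limit K gn g sequentially)))"

subsection \<open>The Hamiltonian of the example\<close>

definition Theta :: "real \<Rightarrow> real" where
  "Theta y = (if y \<ge> 0 then 1 else 0)"

definition hamiltonian :: "real \<Rightarrow> 'h \<Rightarrow> 'h \<Rightarrow> real \<Rightarrow> 'h \<Rightarrow> 'h::real_inner \<Rightarrow> ereal" where
  "hamiltonian \<rho> \<phi> \<psi> s x p =
     (INF a::real. ereal (inner p (a *\<^sub>R \<phi>) + exp (- \<rho> * s) * Theta (inner x \<psi>) * a\<^sup>2))"

end

theory Submission
  imports Defs
begin

text \<open>
  Write \<open>y = \<langle>x, \<psi>\<rangle>\<close> and \<open>m = max 0 y\<close>, so that \<open>v(s,x) = \<alpha> exp (-\<rho>s) m\<^sup>2\<close>.  Away from the hyperplane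
  \<open>y = 0\<close> the equation holds classically: since \<open>A\<^sup>*\<psi> = lam \<psi>\<close>, the operator \<open>L0\<close> multiplies \<open>v\<close> by
  \<open>\<kappa> = -\<rho> + 2 lam + \<beta>\<^sup>2\<close>, while minimising the quadratic polynomial in the Hamiltonian gives
  \<open>-\<alpha> \<langle>\<phi>, \<psi>\<rangle>\<^sup>2 v = -\<kappa> v\<close>.  For \<open>y < 0\<close> the cost of the control vanishes, but so does the
  gradient of \<open>v\<close>, and the Hamiltonian is \<open>0\<close> rather than \<open>-\<infinity>\<close> (\<open>hamiltonian_at_gradient\<close>).

  The only obstruction to \<open>v\<close> being a classical solution is the jump of the second derivative of
  \<open>m\<^sup>2\<close> at \<open>y = 0\<close>.  Replacing \<open>m\<^sup>2\<close> by \<open>m\<^sup>3 / (m + e)\<close> removes it.  In \<open>L0\<close> the first and second derivatives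
  occur only multiplied by \<open>y\<close> and \<open>y\<^sup>2\<close> (\<open>L0_profile\<close>), and with these weights they differ from those of
  \<open>m\<^sup>2\<close> by \<open>O(e m)\<close> (\<open>smooth_sq_bound\<close>).  So with \<open>e = 1/(n+1)\<close> the approximations \<open>v\<^sub>n\<close> and the functions
  \<open>L0 v\<^sub>n\<close> converge uniformly on every set on which \<open>s\<close> and \<open>y\<close> are bounded, in particular on compact
  ones.

  All gradients involved are multiples of \<open>\<psi>\<close>.  That \<open>A\<^sup>*\<close> is multiplication by \<open>lam\<close> on this line uses the
  uniqueness of the adjoint, hence the density of the domain of a generator
  (\<open>orthogonal_to_generator_domain\<close>), obtained from the averages of orbits over short intervals.
\<close>

section \<open>Density of the domain of a generator\<close>

text \<open>
  The right derivative of the indefinite integral, in the form in which difference quotients at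
  \<open>0+\<close> occur in the definition of a generator.
\<close>

lemma integral_average_tendsto:
  fixes g :: "real \<Rightarrow> 'a::banach"
  assumes "continuous_on {a..b} g" and "a < b"
  shows "((\<lambda>s. integral {a..a+s} g /\<^sub>R s) \<longlongrightarrow> g a) (at_right 0)"
proof -
  let ?I = "\<lambda>u. integral {a..u} g"
  have "(?I has_vector_derivative g a) (at a within {a..b})"
    using assms by (intro integral_has_vector_derivative) auto
  then have "((\<lambda>y. (1 / norm (y - a)) *\<^sub>R (?I y - (?I a + (y - a) *\<^sub>R g a))) \<longlongrightarrow> 0) (at_right a)"
    using assms(2) by (simp add: has_vector_derivative_def has_derivative_within at_within_Icc_at_right)
  then have "((\<lambda>s. (1 / norm s) *\<^sub>R (?I (a + s) - s *\<^sub>R g a)) \<longlongrightarrow> 0) (at_right 0)"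
    by (subst (asm) filterlim_at_right_to_0) (simp add: add.commute)
  then have "((\<lambda>s. ?I (a + s) /\<^sub>R s - g a) \<longlongrightarrow> 0) (at_right 0)"
  proof (rule Lim_transform_eventually)
    show "\<forall>\<^sub>F s in at_right 0. (1 / norm s) *\<^sub>R (?I (a + s) - s *\<^sub>R g a) = ?I (a + s) /\<^sub>R s - g a"
      using eventually_at_right_less[of "0::real"]
      by eventually_elim (simp add: scaleR_diff_right divide_inverse)
  qed
  then show ?thesis by (rule LIM_zero_cancel)
qed

text \<open>
  A bound near \<open>0\<close> that is uniform in the unit ball cannot be read off from the strong continuity at
  \<open>0\<close>, which only bounds each orbit on an interval depending on the orbit.  Instead, the closed sets
  \<open>X n\<close> of the points whose orbit stays below \<open>n\<close> on \<open>[0, 1/(n+1)]\<close> exhaust the space, so by the Baire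
  category theorem one of them contains a ball; by linearity, a bound on one ball bounds the operators.
\<close>

lemma C0_semigroup_bounded_near_0:
  fixes S :: "real \<Rightarrow> 'h::banach \<Rightarrow> 'h"
  assumes "C0_semigroup S"
  obtains d M where "d > 0" and "\<And>t x. 0 \<le> t \<Longrightarrow> t \<le> d \<Longrightarrow> norm (S t x) \<le> M * norm x"
proof -
  have lin: "bounded_linear (S t)" if "t \<ge> 0" for t
    using assms that by (simp add: C0_semigroup_def)
  define X where "X n = {x. \<forall>t\<in>{0..1 / real (Suc n)}. norm (S t x) \<le> real n}" for n
  have closed: "closed (X n)" for n
  proof -
    have "X n = (\<Inter>t\<in>{0..1 / real (Suc n)}. {x. norm (S t x) \<le> real n})"
      by (auto simp: X_def)
    also have "closed \<dots>"
      using lin by (intro closed_INT ballI closed_Collect_le continuous_intros linear_continuous_on) auto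
    finally show ?thesis .
  qed
  have "x \<in> (\<Union>n. X n)" for x
  proof -
    have lim: "((\<lambda>t. norm (S t x)) \<longlongrightarrow> norm x) (at_right 0)" and "S 0 x = x"
      using assms by (auto simp: C0_semigroup_def intro: tendsto_norm)
    have "\<forall>\<^sub>F t in at_right 0. norm (S t x) < norm x + 1"
      using order_tendstoD(2)[OF lim, of "norm x + 1"] by simp
    then obtain e where e: "e > 0" "\<And>t. 0 < t \<Longrightarrow> t < e \<Longrightarrow> norm (S t x) < norm x + 1"
      by (auto simp: eventually_at_right_field)
    obtain n1 where n1: "norm x + 1 \<le> real n1" using real_arch_simple by blast
    obtain n2 where n2: "1 / real (Suc n2) < e" using nat_approx_posE[OF e(1)] by blast
    let ?n = "max n1 n2"
    have "1 / real (Suc ?n) \<le> 1 / real (Suc n2)" by (intro divide_left_mono) auto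
    then have "norm (S t x) \<le> real ?n" if "t \<in> {0..1 / real (Suc ?n)}" for t
      using e(2)[of t] that n1 n2 \<open>S 0 x = x\<close> by (cases "t = 0") auto
    then have "x \<in> X ?n" by (simp add: X_def)
    then show ?thesis by blast
  qed
  then have "interior (\<Union>n. X n) \<noteq> {}" by (metis UNIV_I UNIV_eq_I empty_iff interior_UNIV)
  then obtain n where "interior (X n) \<noteq> {}"
    using Met_TC.metric_Baire_category_alt[where ?'a='h, of "range X"] closed
    by (auto simp: complete_UNIV)
  then obtain c r where r: "r > 0" "ball c r \<subseteq> X n"
    by (meson equals0I mem_interior)
  show thesis
  proof
    show "1 / real (Suc n) > 0" by simp
    fix t :: real and x :: 'h
    assume t: "0 \<le> t" "t \<le> 1 / real (Suc n)"
    interpret bounded_linear "S t" using lin t by simp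
    show "norm (S t x) \<le> (4 * real n / r) * norm x"
    proof (cases "x = 0")
      case False
      \<comment> \<open>the scaling places \<open>c + u\<close> inside the ball, so that \<open>S t u\<close> is a difference of two bounded values\<close>
      define u where "u = (r / (2 * norm x)) *\<^sub>R x"
      have "norm u = r / 2" using False r by (simp add: u_def)
      then have "c \<in> ball c r" "c + u \<in> ball c r" using r by (auto simp: dist_norm)
      then have "c \<in> X n" "c + u \<in> X n" using r(2) by blast+
      then have "norm (S t c) \<le> n" "norm (S t (c + u)) \<le> n"
        using t by (simp_all add: X_def)
      moreover have "S t u = S t (c + u) - S t c" by (simp add: add)
      ultimately have "norm (S t u) \<le> 2 * n"
        using norm_triangle_ineq4[of "S t (c + u)" "S t c"] by simp
      moreover have "norm (S t u) = (r / (2 * norm x)) * norm (S t x)"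
        using r by (simp add: u_def scaleR)
      ultimately show ?thesis using False r by (simp add: field_simps)
    qed (simp add: zero)
  qed
qed

text \<open>
  Right continuity is immediate from the semigroup law; continuity from the left needs the uniform
  bound on \<open>S a\<close> in \<open>S b x - S a x = S a (S (b - a) x - x)\<close>.
\<close>

lemma C0_semigroup_orbit_continuous_near_0:
  fixes S :: "real \<Rightarrow> 'h::banach \<Rightarrow> 'h"
  assumes "C0_semigroup S"
  obtains d where "d > 0" and "\<And>x. continuous_on {0..d} (\<lambda>t. S t x)"
proof -
  obtain d M where d: "d > 0" and M: "\<And>t x. 0 \<le> t \<Longrightarrow> t \<le> d \<Longrightarrow> norm (S t x) \<le> M * norm x"
    using C0_semigroup_bounded_near_0[OF assms] by blast
  have lin: "bounded_linear (S t)" if "t \<ge> 0" for t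
    using assms that by (simp add: C0_semigroup_def)
  have "continuous_on {0..d} (\<lambda>t. S t x)" for x
    unfolding continuous_on_def
  proof
    fix t assume t: "t \<in> {0..d}"
    have lim: "((\<lambda>r. S r x) \<longlongrightarrow> x) (at_right 0)" and S0: "S 0 x = x"
      using assms by (auto simp: C0_semigroup_def)
    have "((\<lambda>r. S r x) \<longlongrightarrow> x) (at 0 within {0..})"
      using lim by (simp add: at_within_Ici_at_right)
    moreover have "filterlim (\<lambda>s. \<bar>s - t\<bar>) (at 0 within {0..}) (at t within {0..d})"
      unfolding filterlim_at
      by (auto intro!: tendsto_eq_intros simp: eventually_at_filter)
    ultimately have "((\<lambda>s. S \<bar>s - t\<bar> x) \<longlongrightarrow> x) (at t within {0..d})"
      by (rule filterlim_compose)
    then have "((\<lambda>s. M * norm (S \<bar>s - t\<bar> x - x)) \<longlongrightarrow> M * norm (x - x)) (at t within {0..d})"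
      by (intro tendsto_intros)
    then have to0: "((\<lambda>s. M * norm (S \<bar>s - t\<bar> x - x)) \<longlongrightarrow> 0) (at t within {0..d})" by simp
    have step: "norm (S b x - S a x) \<le> M * norm (S (b - a) x - x)"
      if "0 \<le> a" "a \<le> b" "b \<le> d" for a b
    proof -
      have "S (a + (b - a)) x = S a (S (b - a) x)"
        using assms that unfolding C0_semigroup_def by (meson diff_ge_0_iff_ge)
      then have "S b x - S a x = S a (S (b - a) x - x)"
        using that by (simp add: bounded_linear.linear[OF lin] linear_diff)
      then show ?thesis using M that by simp
    qed
    have bound: "norm (S s x - S t x) \<le> M * norm (S \<bar>s - t\<bar> x - x)" if "s \<in> {0..d}" for s
      using step[of t s] step[of s t] t that
      by (cases "s \<le> t") (auto simp: norm_minus_commute)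
    have "((\<lambda>s. S s x - S t x) \<longlongrightarrow> 0) (at t within {0..d})"
      by (rule Lim_null_comparison[OF _ to0]) (use bound in \<open>auto simp: eventually_at_filter\<close>)
    then show "((\<lambda>s. S s x) \<longlongrightarrow> S t x) (at t within {0..d})"
      by (rule LIM_zero_cancel)
  qed
  with d that show thesis by blast
qed

text \<open>
  Applying \<open>S s\<close> to the integral shifts the window \<open>[0,h]\<close> to \<open>[s,h+s]\<close>, and the two windows differ
  only by short intervals at their ends.  Hence the difference quotient tends to \<open>S h x - x\<close>.
\<close>

lemma integral_orbit_in_generator_domain:
  fixes S :: "real \<Rightarrow> 'h::banach \<Rightarrow> 'h"
  assumes "C0_semigroup S" and "is_generator S D A"
    and cont: "continuous_on {0..d} (\<lambda>t. S t x)" and h: "0 < h" "h < d"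
  shows "integral {0..h} (\<lambda>t. S t x) \<in> D"
proof -
  let ?g = "\<lambda>t. S t x"
  let ?J = "integral {0..h} ?g"
  have intg: "?g integrable_on {a..b}" if "0 \<le> a" "b \<le> d" for a b
    using that by (intro integrable_continuous_real continuous_on_subset[OF cont]) auto
  have diff: "S s ?J - ?J = integral {h..h+s} ?g - integral {0..0+s} ?g" if "0 < s" "s < d - h" for s
  proof -
    have "bounded_linear (S s)" using assms(1) that by (simp add: C0_semigroup_def)
    then have "S s ?J = integral {0..h} (S s \<circ> ?g)"
      using intg[of 0 h] h by (intro integral_linear[symmetric]) auto
    also have "\<dots> = integral {0..h} (?g \<circ> (+) s)"
      using assms(1) that by (intro integral_cong) (auto simp: C0_semigroup_def)
    also have "\<dots> = integral {s..h+s} ?g"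
      using integral_shift_Icc_real[of 0 h ?g s] by simp
    finally have "S s ?J = integral {s..h+s} ?g" .
    moreover have "integral {0..s} ?g + integral {s..h+s} ?g = integral {0..h+s} ?g"
      using that h intg by (intro Henstock_Kurzweil_Integration.integral_combine) auto
    moreover have "?J + integral {h..h+s} ?g = integral {0..h+s} ?g"
      using that h intg by (intro Henstock_Kurzweil_Integration.integral_combine) auto
    ultimately show ?thesis by (simp add: algebra_simps)
  qed
  have "((\<lambda>s. integral {h..h+s} ?g /\<^sub>R s - integral {0..0+s} ?g /\<^sub>R s) \<longlongrightarrow> S h x - S 0 x) (at_right 0)"
    using h by (intro tendsto_diff integral_average_tendsto[of _ d] continuous_on_subset[OF cont]) auto
  then have "((\<lambda>s. (S s ?J - ?J) /\<^sub>R s) \<longlongrightarrow> S h x - S 0 x) (at_right 0)"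
  proof (rule Lim_transform_eventually)
    show "\<forall>\<^sub>F s in at_right 0. integral {h..h+s} ?g /\<^sub>R s - integral {0..0+s} ?g /\<^sub>R s = (S s ?J - ?J) /\<^sub>R s"
      unfolding eventually_at_right_field
      using h diff by (intro exI[of _ "d - h"]) (auto simp: scaleR_diff_right)
  qed
  then show ?thesis using assms(2) by (auto simp: is_generator_def)
qed

text \<open>
  The averages of the orbit of \<open>z\<close> over \<open>[0,h]\<close> lie in the generator domain and tend to \<open>z\<close>.
  This is the density of the domain in the form that makes the adjoint unique.
\<close>

lemma orthogonal_to_generator_domain:
  fixes S :: "real \<Rightarrow> 'h::{real_inner, banach} \<Rightarrow> 'h"
  assumes "C0_semigroup S" and "is_generator S D A"
    and orth: "\<And>x. x \<in> D \<Longrightarrow> inner x z = 0"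
  shows "z = 0"
proof -
  obtain d where d: "d > 0" and cont: "\<And>x. continuous_on {0..d} (\<lambda>t. S t x)"
    using C0_semigroup_orbit_continuous_near_0[OF assms(1)] by blast
  let ?a = "\<lambda>h. integral {0..0+h} (\<lambda>t. S t z) /\<^sub>R h"
  have "(?a \<longlongrightarrow> S 0 z) (at_right 0)"
    using cont d by (rule integral_average_tendsto)
  then have "((\<lambda>h. inner (?a h) z) \<longlongrightarrow> inner z z) (at_right 0)"
    using assms(1) by (intro tendsto_inner) (auto simp: C0_semigroup_def)
  moreover have "((\<lambda>h. inner (?a h) z) \<longlongrightarrow> 0) (at_right 0)"
  proof (rule tendsto_eventually)
    show "\<forall>\<^sub>F h in at_right 0. inner (?a h) z = 0"
      unfolding eventually_at_right_field
      using d integral_orbit_in_generator_domain[OF assms(1,2) cont] orth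
      by (intro exI[of _ d]) auto
  qed
  ultimately have "inner z z = 0" by (rule tendsto_unique[rotated]) simp
  then show ?thesis by simp
qed

section \<open>Twice differentiable approximations of the squared positive part\<close>

text \<open>
  Composition with the positive part keeps \<open>C\<^sup>1\<close> regularity across the kink at \<open>0\<close> exactly because the
  derivative vanishes there.  Applied once to \<open>m\<^sup>2\<close> it gives the regularity of the value function;
  applied twice to \<open>smooth_sq e\<close> it gives that of its approximations.
\<close>

lemma has_real_derivative_pos_part_compose:
  fixes p :: "real \<Rightarrow> real"
  assumes p: "\<And>m. m \<ge> 0 \<Longrightarrow> (p has_real_derivative p' m) (at m)" and "p' 0 = 0"
  shows "((\<lambda>y. p (max 0 y)) has_real_derivative p' (max 0 y)) (at y)"
proof -
  have p0: "(p has_vector_derivative p' m) (at m within X)" if "m \<ge> 0" for m X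
    using p[OF that] by (simp add: has_real_derivative_iff_has_vector_derivative has_vector_derivative_at_within)
  have "((\<lambda>y. if y \<in> {0..} then p y else p 0) has_vector_derivative (if y \<in> {0..} then p' y else 0)) (at y within UNIV)"
  proof (rule has_vector_derivative_If_within_closures[where T = "{..<0}"])
    show "UNIV = {0::real..} \<union> {..<0}" "y \<in> {0..} \<union> {..<0}" by auto
    show "(p has_vector_derivative p' y) (at y within {0..} \<union> closure {0..} \<inter> closure {..<0})"
      if "y \<in> {0..} \<union> closure {0..} \<inter> closure {..<0}"
      using that by (intro p0) auto
    show "((\<lambda>y. p 0) has_vector_derivative 0) (at y within {..<0} \<union> closure {0..} \<inter> closure {..<0})"
      by simp
    show "p y = p 0" "p' y = 0" if "y \<in> closure {0..}" "y \<in> closure {..<0}"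
    proof -
      have "y = 0" using that by simp
      then show "p y = p 0" "p' y = 0" using assms(2) by simp_all
    qed
  qed
  moreover have "(if y \<in> {0..} then p' y else 0) = p' (max 0 y)"
    using assms(2) by (cases "y \<ge> 0") (simp_all add: max_def)
  moreover have "(\<lambda>y. if y \<in> {0..} then p y else p 0) = (\<lambda>y. p (max 0 y))"
    by (rule ext) (simp add: max_def)
  ultimately show ?thesis by (simp only: has_real_derivative_iff_has_vector_derivative)
qed

text \<open>
  The function \<open>m \<mapsto> (max 0 m)\<^sup>2\<close> fails to be \<open>C\<^sup>2\<close> at \<open>0\<close>, where its second derivative jumps from \<open>0\<close> to
  \<open>2\<close>.  On the half line \<open>m \<ge> 0\<close> the rational function below is close to \<open>m\<^sup>2\<close>, but vanishes
  to third order at \<open>0\<close>, so that its extension by \<open>0\<close> to negative \<open>m\<close> is \<open>C\<^sup>2\<close>.  The functions \<open>smooth_sq'\<close>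
  and \<open>smooth_sq''\<close> are its first two derivatives.
\<close>

definition smooth_sq :: "real \<Rightarrow> real \<Rightarrow> real" where
  "smooth_sq e m = m ^ 3 / (m + e)"

definition smooth_sq' :: "real \<Rightarrow> real \<Rightarrow> real" where
  "smooth_sq' e m = (2 * m ^ 3 + 3 * e * m\<^sup>2) / (m + e)\<^sup>2"

definition smooth_sq'' :: "real \<Rightarrow> real \<Rightarrow> real" where
  "smooth_sq'' e m = 2 - 2 * e ^ 3 / (m + e) ^ 3"

text \<open>
  With \<open>u = m + e\<close> and \<open>r = e/u\<close>, the quotients defining \<open>smooth_sq\<close> and its derivatives become
  polynomials in \<open>r\<close> and \<open>u\<close>, and the identities below become polynomial ones.
\<close>

lemma homogeneous_coordinates:
  fixes e m :: real
  assumes "e > 0" "m \<ge> 0"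
  obtains r u where "u > 0" "0 \<le> r" "r \<le> 1" "e = r * u" "m = (1 - r) * u"
proof
  show "m + e > 0" "0 \<le> e / (m + e)" "e / (m + e) \<le> 1" "e = e / (m + e) * (m + e)"
    using assms by (auto simp: divide_simps)
  show "m = (1 - e / (m + e)) * (m + e)"
    using assms by (simp add: left_diff_distrib)
qed

lemma smooth_sq_homogeneous:
  fixes r u :: real
  assumes "u > 0"
  shows "smooth_sq (r * u) ((1 - r) * u) = (1 - r) ^ 3 * u\<^sup>2"
    and "smooth_sq' (r * u) ((1 - r) * u) = (2 * (1 - r) ^ 3 + 3 * r * (1 - r)\<^sup>2) * u"
    and "smooth_sq'' (r * u) ((1 - r) * u) = 2 - 2 * r ^ 3"
proof -
  have sum: "(1 - r) * u + r * u = u" by (simp add: algebra_simps)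
  show "smooth_sq (r * u) ((1 - r) * u) = (1 - r) ^ 3 * u\<^sup>2"
    using assms unfolding smooth_sq_def sum
    by (simp add: power_mult_distrib power3_eq_cube power2_eq_square)
  show "smooth_sq' (r * u) ((1 - r) * u) = (2 * (1 - r) ^ 3 + 3 * r * (1 - r)\<^sup>2) * u"
    using assms unfolding smooth_sq'_def sum
    by (simp add: power_mult_distrib power3_eq_cube power2_eq_square field_simps)
  show "smooth_sq'' (r * u) ((1 - r) * u) = 2 - 2 * r ^ 3"
    using assms unfolding smooth_sq''_def sum by (simp add: power_mult_distrib)
qed

lemma smooth_sq_deriv:
  assumes "e > 0" "m \<ge> 0"
  shows "(smooth_sq e has_real_derivative smooth_sq' e m) (at m)"
    and "(smooth_sq' e has_real_derivative smooth_sq'' e m) (at m)"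
proof -
  obtain r u where ru: "u > 0" "e = r * u" "m = (1 - r) * u"
    using homogeneous_coordinates[OF assms] by metis
  have u: "m + e = u" by (simp add: ru algebra_simps)
  have me: "m + e \<noteq> 0" using assms by simp
  have "((\<lambda>m. m ^ 3 / (m + e)) has_real_derivative
      ((3 * m\<^sup>2) * (m + e) - m ^ 3 * 1) / ((m + e) * (m + e))) (at m)"
    using me by (intro DERIV_divide) (auto intro!: derivative_eq_intros)
  moreover have "((3 * m\<^sup>2) * (m + e) - m ^ 3 * 1) / ((m + e) * (m + e)) = smooth_sq' e m"
    by (simp add: smooth_sq'_def algebra_simps power2_eq_square power3_eq_cube)
  ultimately show "(smooth_sq e has_real_derivative smooth_sq' e m) (at m)"
    unfolding smooth_sq_def[abs_def] by simp
  let ?d = "\<lambda>m u. ((6 * m\<^sup>2 + 6 * e * m) * u\<^sup>2 - (2 * m ^ 3 + 3 * e * m\<^sup>2) * (2 * u)) / (u\<^sup>2 * u\<^sup>2)"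
  have "((\<lambda>m. (2 * m ^ 3 + 3 * e * m\<^sup>2) / (m + e)\<^sup>2) has_real_derivative ?d m (m + e)) (at m)"
    using me by (intro DERIV_divide) (auto intro!: derivative_eq_intros)
  moreover have "?d m u = smooth_sq'' e m"
  proof -
    have "(6 * m\<^sup>2 + 6 * e * m) * u\<^sup>2 - (2 * m ^ 3 + 3 * e * m\<^sup>2) * (2 * u) = (2 - 2 * r ^ 3) * (u\<^sup>2 * u\<^sup>2)"
      unfolding ru by algebra
    then show ?thesis
      using ru(1) by (simp add: smooth_sq_homogeneous(3) ru(2,3))
  qed
  ultimately show "(smooth_sq' e has_real_derivative smooth_sq'' e m) (at m)"
    unfolding smooth_sq'_def[abs_def] u by simp
qed

text \<open>
  The second derivatives do not converge uniformly near \<open>0\<close>: at \<open>m = 0\<close> they vanish for every \<open>e\<close>.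
  The operator \<open>L0\<close>, however, only sees \<open>m\<^sup>2 * smooth_sq'' e m\<close>, and the factor \<open>m\<^sup>2\<close> restores
  convergence.
\<close>

lemma smooth_sq_bound:
  assumes "e > 0" "m \<ge> 0"
  shows "\<bar>smooth_sq e m - m\<^sup>2\<bar> \<le> e * m"
    and "\<bar>m * smooth_sq' e m - 2 * m\<^sup>2\<bar> \<le> 2 * (e * m)"
    and "\<bar>m\<^sup>2 * smooth_sq'' e m - 2 * m\<^sup>2\<bar> \<le> 2 * (e * m)"
proof -
  obtain r u where r: "u > 0" "0 \<le> r" "r \<le> 1" and ru: "e = r * u" "m = (1 - r) * u"
    using homogeneous_coordinates[OF assms] by metis
  note hom = smooth_sq_homogeneous[OF r(1), of r, folded ru]
  have le: "\<bar>- (e * m * c)\<bar> \<le> k * (e * m)" if "0 \<le> c" "c \<le> k" for c k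
    using mult_left_mono[OF that(2), of "e * m"] that(1) assms by (simp add: abs_mult mult_ac)
  have "smooth_sq e m - m\<^sup>2 = - (e * m * (1 - r))"
    unfolding hom unfolding ru by algebra
  then show "\<bar>smooth_sq e m - m\<^sup>2\<bar> \<le> e * m"
    using le[of "1 - r" 1] r by simp
  have "m * smooth_sq' e m - 2 * m\<^sup>2 = - (e * m * ((1 - r) * (1 + r)))"
    unfolding hom unfolding ru by algebra
  moreover have "(1 - r) * (1 + r) \<le> 1 * 2"
    using r by (intro mult_mono) auto
  ultimately show "\<bar>m * smooth_sq' e m - 2 * m\<^sup>2\<bar> \<le> 2 * (e * m)"
    using le[of "(1 - r) * (1 + r)" 2] r by simp
  have "m\<^sup>2 * smooth_sq'' e m - 2 * m\<^sup>2 = - (e * m * (2 * ((1 - r) * r\<^sup>2)))"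
    unfolding hom unfolding ru by algebra
  moreover have "(1 - r) * r\<^sup>2 \<le> 1 * 1"
    using r by (intro mult_mono power_le_one) auto
  ultimately show "\<bar>m\<^sup>2 * smooth_sq'' e m - 2 * m\<^sup>2\<bar> \<le> 2 * (e * m)"
    using le[of "2 * ((1 - r) * r\<^sup>2)" 2] r by simp
qed

section \<open>Gradient and Hessian of functions of one coordinate\<close>

text \<open>
  The rank one operator \<open>h \<mapsto> \<langle>h, \<psi>\<rangle> \<psi>\<close>.
\<close>

definition tensor_square :: "'h::real_inner \<Rightarrow> 'h \<Rightarrow>\<^sub>L 'h" where
  "tensor_square \<psi> = blinfun_scaleR_left \<psi> o\<^sub>L blinfun_inner_left \<psi>"

lemma gderiv_inner_compose:
  assumes "(w has_real_derivative w') (at (inner x \<psi>))"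
  shows "GDERIV (\<lambda>x. c * w (inner x \<psi>)) x :> (c * w') *\<^sub>R \<psi>"
proof -
  have "GDERIV (\<lambda>x. inner x \<psi>) x :> \<psi>"
    by (auto simp: gderiv_def intro!: derivative_eq_intros)
  then show ?thesis
    using DERIV_cmult[OF assms, of c] by (rule GDERIV_DERIV_compose)
qed

lemma grad_eqI:
  assumes "GDERIV f x :> d"
  shows "grad f x = d"
  unfolding grad_def
proof (rule the_equality[where P="\<lambda>D. GDERIV f x :> D", OF assms])
  fix d' assume "GDERIV f x :> d'"
  with assms have "(\<lambda>h. inner h d') = (\<lambda>h. inner h d)"
    unfolding gderiv_def by (rule has_derivative_unique[rotated])
  then show "d' = d" by (metis vector_eq_ldot)
qed

lemma hessian_eqI:
  assumes "(grad f has_derivative blinfun_apply L) (at x)"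
  shows "hessian f x = L"
  unfolding hessian_def
proof (rule the_equality[where P="\<lambda>L. (grad f has_derivative blinfun_apply L) (at x)", OF assms])
  fix L' assume "(grad f has_derivative blinfun_apply L') (at x)"
  with assms have "blinfun_apply L' = blinfun_apply L"
    by (rule has_derivative_unique[rotated])
  then show "L' = L" by (simp add: blinfun_apply_inject)
qed

section \<open>Maps into the line of an eigenvector of the adjoint\<close>

text \<open>
  Since \<open>D\<close> has trivial orthogonal complement, the adjoint is unique, so \<open>A\<^sup>*\<close> acts on the line through \<open>\<psi>\<close> as
  multiplication by \<open>lam\<close>, and the graph norm is a multiple of the norm on that line.  Maps into this line are continuous for the graph norm as soon as
  their scalar coefficient is continuous.
\<close>

locale adjoint_eigenvector =
  fixes D :: "'h::real_inner set" and A :: "'h \<Rightarrow> 'h" and \<psi> :: 'h and lam :: real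
  assumes dense: "\<And>z. (\<And>x. x \<in> D \<Longrightarrow> inner x z = 0) \<Longrightarrow> z = 0"
    and adj_dom: "\<psi> \<in> adj_dom D A" and eigen: "adj_op D A \<psi> = lam *\<^sub>R \<psi>"
begin

lemma adj_op_eqI:
  assumes "\<And>x. x \<in> D \<Longrightarrow> inner (A x) y = inner x z"
  shows "adj_op D A y = z"
  unfolding adj_op_def
proof (rule the_equality)
  fix z' assume "\<forall>x\<in>D. inner (A x) y = inner x z'"
  then have "z' - z = 0" using assms by (intro dense) (simp add: inner_diff_right)
  then show "z' = z" by simp
qed (use assms in blast)

lemma inner_eigenvector: "x \<in> D \<Longrightarrow> inner (A x) (c *\<^sub>R \<psi>) = inner x ((c * lam) *\<^sub>R \<psi>)"
proof -
  assume x: "x \<in> D"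
  obtain z where z: "\<And>x. x \<in> D \<Longrightarrow> inner (A x) \<psi> = inner x z"
    using adj_dom by (auto simp: adj_dom_def)
  then have "z = lam *\<^sub>R \<psi>" using adj_op_eqI eigen by simp
  then show ?thesis using z[OF x] by simp
qed

lemma scaleR_mem_adj_dom: "c *\<^sub>R \<psi> \<in> adj_dom D A"
  unfolding adj_dom_def using inner_eigenvector by blast

lemma adj_op_scaleR: "adj_op D A (c *\<^sub>R \<psi>) = (c * lam) *\<^sub>R \<psi>"
  using inner_eigenvector by (rule adj_op_eqI)

lemma graph_norm_scaleR: "graph_norm D A (c *\<^sub>R \<psi>) = \<bar>c\<bar> * graph_norm D A \<psi>"
  by (simp add: graph_norm_def adj_op_scaleR eigen abs_mult algebra_simps)

lemma continuous_into_adj_scaleR: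
  assumes "continuous_on X a"
  shows "continuous_into_adj D A X (\<lambda>p. a p *\<^sub>R \<psi>)"
proof -
  have "((\<lambda>q. graph_norm D A (a q *\<^sub>R \<psi> - a p *\<^sub>R \<psi>)) \<longlongrightarrow> 0) (at p within X)" if "p \<in> X" for p
  proof -
    have "((\<lambda>q. \<bar>a q - a p\<bar> * graph_norm D A \<psi>) \<longlongrightarrow> \<bar>a p - a p\<bar> * graph_norm D A \<psi>) (at p within X)"
      using assms that by (intro tendsto_intros) (simp add: continuous_on_def)
    then show ?thesis by (simp add: graph_norm_scaleR flip: scaleR_left_diff_distrib)
  qed
  then show ?thesis by (simp add: continuous_into_adj_def scaleR_mem_adj_dom)
qed

lemma UC_into_adj_scaleR:
  assumes "\<And>c r. uniformly_continuous_on (ball c r) a"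
  shows "UC_into_adj D A X (\<lambda>p. a p *\<^sub>R \<psi>)"
  unfolding UC_into_adj_def
proof (intro conjI ballI allI impI)
  fix c r and \<epsilon> :: real assume "\<epsilon> > 0"
  let ?g = "graph_norm D A \<psi>"
  have g: "?g \<ge> 0" by (simp add: graph_norm_def)
  then have "\<epsilon> / (?g + 1) > 0" using \<open>\<epsilon> > 0\<close> by simp
  then obtain d where d: "d > 0"
    "\<And>p q. p \<in> ball c r \<Longrightarrow> q \<in> ball c r \<Longrightarrow> dist p q < d \<Longrightarrow> dist (a p) (a q) < \<epsilon> / (?g + 1)"
    using assms[of c r] unfolding uniformly_continuous_on_def by (metis dist_commute)
  have "graph_norm D A (a p *\<^sub>R \<psi> - a q *\<^sub>R \<psi>) < \<epsilon>"
    if "p \<in> ball c r" "q \<in> ball c r" "dist p q < d" for p q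
  proof -
    have "\<bar>a p - a q\<bar> * ?g \<le> \<bar>a p - a q\<bar> * (?g + 1)" by (simp add: mult_left_mono)
    also have "\<dots> < \<epsilon>" using d(2)[OF that] g by (simp add: dist_real_def field_simps)
    finally show ?thesis by (simp add: graph_norm_scaleR flip: scaleR_left_diff_distrib)
  qed
  with d(1) show "\<exists>\<delta>>0. \<forall>p\<in>X \<inter> ball c r. \<forall>q\<in>X \<inter> ball c r.
      dist p q < \<delta> \<longrightarrow> graph_norm D A (a p *\<^sub>R \<psi> - a q *\<^sub>R \<psi>) < \<epsilon>" by blast
qed (rule scaleR_mem_adj_dom)

end

section \<open>Functions in separated form\<close>

text \<open>
  The value function and its approximations all have this separated form, and the form is stable
  under the operations of the problem: the time derivative multiplies by \<open>-\<rho>\<close>, the gradient replaces \<open>w\<close>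
  by \<open>w'\<close> and points along \<open>\<psi>\<close>, and \<open>L0\<close> acts as an ordinary differential operator on \<open>w\<close>.
\<close>

definition profile :: "real \<Rightarrow> real \<Rightarrow> 'h::real_inner \<Rightarrow> (real \<Rightarrow> real) \<Rightarrow> real \<Rightarrow> 'h \<Rightarrow> real" where
  "profile c \<rho> \<psi> w s x = c * exp (- \<rho> * s) * w (inner x \<psi>)"

lemma continuous_on_profile:
  assumes "continuous_on UNIV w"
  shows "continuous_on X (\<lambda>(s, x). profile c \<rho> \<psi> w s x)"
  unfolding profile_def split_def
  by (intro continuous_intros continuous_on_compose2[OF assms]) auto

text \<open>
  Bounded sets need not be relatively compact in infinite dimension, but a profile factors through
  \<open>(s, x) \<mapsto> (s, \<langle>x, \<psi>\<rangle>)\<close>, which maps them into bounded subsets of the plane.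
\<close>

lemma uniformly_continuous_on_profile:
  assumes "continuous_on UNIV w" and "bounded X"
  shows "uniformly_continuous_on X (\<lambda>(s, x). profile c \<rho> \<psi> w s x)"
proof -
  define L where "L = (\<lambda>(s::real, x). (s, inner x \<psi>))"
  have L: "bounded_linear L"
    unfolding L_def split_def
    by (intro bounded_linear_Pair bounded_linear_fst bounded_linear_compose[OF bounded_linear_inner_left]
        bounded_linear_snd)
  define f where "f = (\<lambda>(s, y). c * exp (- \<rho> * s) * w y)"
  have "compact (closure (L ` X))"
    using bounded_linear_image[OF assms(2) L] by (simp add: compact_closure)
  moreover have "continuous_on (closure (L ` X)) f"
    unfolding f_def split_def
    by (intro continuous_intros continuous_on_compose2[OF assms(1)]) auto
  ultimately have "uniformly_continuous_on (L ` X) f"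
    using compact_uniformly_continuous[of "closure (L ` X)" f] closure_subset[of "L ` X"]
    unfolding uniformly_continuous_on_def by (meson subsetD)
  then have "uniformly_continuous_on X (\<lambda>p. f (L p))"
    by (rule uniformly_continuous_on_compose[OF bounded_linear.uniformly_continuous_on[OF L uniformly_continuous_on_id]])
  then show ?thesis by (simp add: f_def L_def profile_def split_def)
qed

text \<open>
  The error is at most \<open>e n\<close> times a fixed continuous function, which is bounded on \<open>K\<close>.
\<close>

lemma uniform_limit_profile:
  assumes bound: "\<And>n y. \<bar>W n y - w y\<bar> \<le> e n * b y" and "e \<longlonglongrightarrow> 0"
    and "continuous_on UNIV b" and "compact K"
  shows "uniform_limit K (\<lambda>n (s, x). profile c \<rho> \<psi> (W n) s x) (\<lambda>(s, x). profile c \<rho> \<psi> w s x) sequentially"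
proof -
  have "compact ((\<lambda>(s, x). profile c \<rho> \<psi> b s x) ` K)"
    using assms by (intro compact_continuous_image continuous_on_profile)
  then obtain B where B: "\<And>s x. (s, x) \<in> K \<Longrightarrow> \<bar>profile c \<rho> \<psi> b s x\<bar> \<le> B"
    by (force dest!: compact_imp_bounded simp: bounded_iff)
  have dist: "dist (profile c \<rho> \<psi> (W n) s x) (profile c \<rho> \<psi> w s x) \<le> \<bar>e n\<bar> * B" if "(s, x) \<in> K" for n s x
  proof -
    let ?y = "inner x \<psi>"
    have "dist (profile c \<rho> \<psi> (W n) s x) (profile c \<rho> \<psi> w s x) = \<bar>c * exp (- \<rho> * s)\<bar> * \<bar>W n ?y - w ?y\<bar>"
      by (simp add: profile_def dist_real_def flip: abs_mult right_diff_distrib)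
    also have "\<dots> \<le> \<bar>c * exp (- \<rho> * s)\<bar> * \<bar>e n * b ?y\<bar>"
      using bound[of n ?y] by (intro mult_left_mono) auto
    also have "\<dots> = \<bar>e n\<bar> * \<bar>profile c \<rho> \<psi> b s x\<bar>"
      by (simp add: profile_def abs_mult mult_ac)
    also have "\<dots> \<le> \<bar>e n\<bar> * B" using B[OF that] by (intro mult_left_mono) auto
    finally show ?thesis .
  qed
  have "(\<lambda>n. \<bar>e n\<bar> * B) \<longlonglongrightarrow> 0"
    using assms(2) by (auto intro!: tendsto_eq_intros)
  show ?thesis
  proof (rule uniform_limitI)
    fix \<epsilon> :: real assume "\<epsilon> > 0"
    with \<open>(\<lambda>n. \<bar>e n\<bar> * B) \<longlonglongrightarrow> 0\<close> have "\<forall>\<^sub>F n in sequentially. \<bar>e n\<bar> * B < \<epsilon>"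
      by (rule order_tendstoD)
    then show "\<forall>\<^sub>F n in sequentially. \<forall>p\<in>K. dist (case p of (s, x) \<Rightarrow> profile c \<rho> \<psi> (W n) s x)
        (case p of (s, x) \<Rightarrow> profile c \<rho> \<psi> w s x) < \<epsilon>"
      by eventually_elim (use dist in \<open>auto intro: le_less_trans\<close>)
  qed
qed

lemma gderiv_profile:
  assumes "\<And>y. (w has_real_derivative w' y) (at y)"
  shows "GDERIV (profile c \<rho> \<psi> w s) x :> profile c \<rho> \<psi> w' s x *\<^sub>R \<psi>"
  using gderiv_inner_compose[OF assms, of "c * exp (- \<rho> * s)"]
  by (simp add: profile_def[abs_def])

lemma grad_profile:
  assumes "\<And>y. (w has_real_derivative w' y) (at y)"
  shows "grad (profile c \<rho> \<psi> w s) x = profile c \<rho> \<psi> w' s x *\<^sub>R \<psi>"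
  using gderiv_profile[OF assms] by (rule grad_eqI)

lemma C01_profile:
  assumes "\<And>y. (w has_real_derivative w' y) (at y)" and "continuous_on UNIV w'"
  shows "C01 I (profile c \<rho> \<psi> w)"
proof -
  have "continuous_on UNIV w"
    using assms(1) by (auto intro: DERIV_continuous_on)
  moreover have "continuous_on X (\<lambda>p. (case p of (s, x) \<Rightarrow> profile c \<rho> \<psi> w' s x) *\<^sub>R \<psi>)" for X
    using assms(2) by (intro continuous_intros continuous_on_profile)
  ultimately show ?thesis
    using gderiv_profile[OF assms(1)] continuous_on_profile[of w]
    unfolding C01_def grad_profile[OF assms(1)] split_def by blast
qed

lemma has_derivative_grad_profile:
  assumes "\<And>y. (w has_real_derivative w' y) (at y)"
    and "\<And>y. (w' has_real_derivative w'' y) (at y)"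
  shows "(grad (profile c \<rho> \<psi> w s) has_derivative
    blinfun_apply (profile c \<rho> \<psi> w'' s x *\<^sub>R tensor_square \<psi>)) (at x)"
proof -
  have "(profile c \<rho> \<psi> w' s has_derivative (\<lambda>h. inner h (profile c \<rho> \<psi> w'' s x *\<^sub>R \<psi>))) (at x)"
    using gderiv_profile[OF assms(2)] by (simp add: gderiv_def)
  then have "((\<lambda>x. profile c \<rho> \<psi> w' s x *\<^sub>R \<psi>) has_derivative
      (\<lambda>h. inner h (profile c \<rho> \<psi> w'' s x *\<^sub>R \<psi>) *\<^sub>R \<psi>)) (at x)"
    by (rule has_derivative_scaleR_left)
  moreover have "grad (profile c \<rho> \<psi> w s) = (\<lambda>x. profile c \<rho> \<psi> w' s x *\<^sub>R \<psi>)"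
    using grad_profile[OF assms(1)] by blast
  moreover have "(\<lambda>h. inner h (profile c \<rho> \<psi> w'' s x *\<^sub>R \<psi>) *\<^sub>R \<psi>)
      = blinfun_apply (profile c \<rho> \<psi> w'' s x *\<^sub>R tensor_square \<psi>)"
    by (auto simp: tensor_square_def scaleR_blinfun.rep_eq)
  ultimately show ?thesis by simp
qed

lemma hessian_profile:
  assumes "\<And>y. (w has_real_derivative w' y) (at y)"
    and "\<And>y. (w' has_real_derivative w'' y) (at y)"
  shows "hessian (profile c \<rho> \<psi> w s) x = profile c \<rho> \<psi> w'' s x *\<^sub>R tensor_square \<psi>"
  using has_derivative_grad_profile[OF assms] by (rule hessian_eqI)

lemma has_vector_derivative_profile:
  "((\<lambda>r. profile c \<rho> \<psi> w r x) has_vector_derivative - \<rho> * profile c \<rho> \<psi> w s x) (at s within X)"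
  unfolding profile_def has_real_derivative_iff_has_vector_derivative[symmetric]
  by (auto intro!: derivative_eq_intros)

lemma time_deriv_profile:
  assumes "T > 0" and "s \<in> {0..T}"
  shows "time_deriv T (profile c \<rho> \<psi> w) s x = - \<rho> * profile c \<rho> \<psi> w s x"
  unfolding time_deriv_def
  using assms has_vector_derivative_profile by (rule vector_derivative_within_closed_interval)

lemma C12_profile:
  assumes "T > 0"
    and w: "\<And>y. (w has_real_derivative w' y) (at y)"
    and w': "\<And>y. (w' has_real_derivative w'' y) (at y)"
    and "continuous_on UNIV w''"
  shows "C12 T (profile c \<rho> \<psi> w)"
  unfolding C12_def
proof (intro conjI ballI allI)
  have cont: "continuous_on UNIV w" "continuous_on UNIV w'"
    using w w' by (auto intro: DERIV_continuous_on)
  then show "C01 {0..T} (profile c \<rho> \<psi> w)" by (intro C01_profile[OF w])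
  have "continuous_on ({0..T} \<times> UNIV) (\<lambda>p. - \<rho> * (case p of (s, x) \<Rightarrow> profile c \<rho> \<psi> w s x))"
    using cont by (intro continuous_intros continuous_on_profile)
  then show "continuous_on ({0..T} \<times> UNIV) (\<lambda>(s, x). time_deriv T (profile c \<rho> \<psi> w) s x)"
    by (rule continuous_on_eq) (auto simp: time_deriv_profile[OF assms(1)])
  have "continuous_on ({0..T} \<times> UNIV) (\<lambda>p. (case p of (s, x) \<Rightarrow> profile c \<rho> \<psi> w'' s x) *\<^sub>R tensor_square \<psi>)"
    using assms(4) by (intro continuous_intros continuous_on_profile)
  then show "continuous_on ({0..T} \<times> UNIV) (\<lambda>(s, x). hessian (profile c \<rho> \<psi> w s) x)"
    by (simp add: hessian_profile[OF w w'] split_def)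
  show "(\<lambda>r. profile c \<rho> \<psi> w r x) differentiable (at s within {0..T})" for s x
    using has_vector_derivative_profile by (rule differentiableI_vector)
  show "grad (profile c \<rho> \<psi> w s) differentiable (at x)" for s x
    using has_derivative_grad_profile[OF w w'] by (rule differentiableI)
qed

context adjoint_eigenvector
begin

lemma profile_in_dom_L0:
  assumes "T > 0"
    and w: "\<And>y. (w has_real_derivative w' y) (at y)"
    and w': "\<And>y. (w' has_real_derivative w'' y) (at y)"
    and "continuous_on UNIV w''"
  shows "profile c \<rho> \<psi> w \<in> dom_L0 T D A"
proof -
  have "continuous_on UNIV w'" using w' by (auto intro: DERIV_continuous_on)
  then show ?thesis
    using C12_profile[OF assms]
      continuous_into_adj_scaleR[OF continuous_on_profile, of w' "{0..T} \<times> UNIV" c \<rho> \<psi>]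
    by (simp add: dom_L0_def grad_profile[OF w] split_def)
qed

text \<open>
  The Euler type operator \<open>y \<mapsto> y w'\<close> comes from \<open>\<langle>A\<^sup>* \<psi>, x\<rangle> = lam \<langle>x, \<psi>\<rangle>\<close>, and the coefficient \<open>y\<^sup>2\<close> of
  \<open>w''\<close> from evaluating the Hessian twice at \<open>x\<close>.  On \<open>w = y\<^sup>2\<close> it is multiplication by
  \<open>-\<rho> + 2 lam + \<beta>\<^sup>2\<close>.
\<close>

lemma L0_profile:
  assumes "T > 0" "s \<in> {0..T}"
    and w: "\<And>y. (w has_real_derivative w' y) (at y)"
    and w': "\<And>y. (w' has_real_derivative w'' y) (at y)"
  shows "L0 T D A \<beta> (profile c \<rho> \<psi> w) s x =
    profile c \<rho> \<psi> (\<lambda>y. - \<rho> * w y + lam * (y * w' y) + 1/2 * \<beta>\<^sup>2 * (y\<^sup>2 * w'' y)) s x"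
  by (simp add: L0_def time_deriv_profile[OF assms(1,2)] grad_profile[OF w] hessian_profile[OF w w']
      adj_op_scaleR tensor_square_def scaleR_blinfun.rep_eq profile_def inner_commute[of \<psi> x]
      power2_eq_square algebra_simps)

end

section \<open>The Hamiltonian along the gradient\<close>

lemma INF_quadratic:
  fixes b c :: real
  assumes "c > 0"
  shows "(INF a::real. ereal (a * b + c * a\<^sup>2)) = ereal (- b\<^sup>2 / (4 * c))"
proof -
  define k where "k = b / (2 * c)"
  have b: "b = 2 * c * k" using assms by (simp add: k_def)
  have min: "- b\<^sup>2 / (4 * c) = - (c * k\<^sup>2)"
    using assms by (simp add: b power2_eq_square)
  have square: "a * b + c * a\<^sup>2 = c * (a + k)\<^sup>2 - c * k\<^sup>2" for a
    unfolding b by algebra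
  show ?thesis
    unfolding min
  proof (rule antisym)
    show "(INF a::real. ereal (a * b + c * a\<^sup>2)) \<le> ereal (- (c * k\<^sup>2))"
      by (rule INF_lower2[of "- k"]) (unfold square, simp_all)
    show "ereal (- (c * k\<^sup>2)) \<le> (INF a::real. ereal (a * b + c * a\<^sup>2))"
      using assms by (intro INF_greatest) (simp add: square)
  qed
qed

text \<open>
  Where \<open>\<langle>x, \<psi>\<rangle> < 0\<close> the control is free of cost, so the infimum is finite only for \<open>\<langle>p, \<phi>\<rangle> = 0\<close>; the
  gradient of the value function vanishes there.  On the other half space the infimum is that of a
  quadratic polynomial with leading coefficient \<open>exp (- \<rho> * s)\<close>.
\<close>

lemma hamiltonian_at_gradient:
  "hamiltonian \<rho> \<phi> \<psi> s x (profile \<alpha> \<rho> \<psi> (\<lambda>y. 2 * max 0 y) s x *\<^sub>R \<psi>)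
    = ereal (- profile \<alpha> \<rho> \<psi> (\<lambda>y. \<alpha> * (inner \<phi> \<psi>)\<^sup>2 * (max 0 y)\<^sup>2) s x)"
proof (cases "inner x \<psi> \<ge> 0")
  case True
  let ?E = "exp (- \<rho> * s)" and ?y = "inner x \<psi>"
  let ?b = "\<alpha> * ?E * (2 * ?y) * inner \<psi> \<phi>"
  have "hamiltonian \<rho> \<phi> \<psi> s x (profile \<alpha> \<rho> \<psi> (\<lambda>y. 2 * max 0 y) s x *\<^sub>R \<psi>)
      = (INF a::real. ereal (a * ?b + ?E * a\<^sup>2))"
    using True by (simp add: hamiltonian_def profile_def Theta_def max_def mult_ac)
  also have "\<dots> = ereal (- ?b\<^sup>2 / (4 * ?E))" by (rule INF_quadratic) simp
  also have "- ?b\<^sup>2 / (4 * ?E) = - profile \<alpha> \<rho> \<psi> (\<lambda>y. \<alpha> * (inner \<phi> \<psi>)\<^sup>2 * (max 0 y)\<^sup>2) s x"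
    using True by (simp add: profile_def max_def inner_commute[of \<psi> \<phi>] power2_eq_square)
  finally show ?thesis .
next
  case False
  then show ?thesis by (simp add: hamiltonian_def profile_def Theta_def max_def)
qed

section \<open>The value function as a strong solution\<close>

theorem lemma5p1:
  fixes S :: "real \<Rightarrow> 'h \<Rightarrow> 'h::{real_inner, banach}"
    and D :: "'h set" and A :: "'h \<Rightarrow> 'h"
    and T \<rho> \<beta> lam \<alpha> :: real and \<phi> \<psi> :: 'h
    and v :: "real \<Rightarrow> 'h \<Rightarrow> real" and g :: "'h \<Rightarrow> real"
  assumes "T > 0"
    and "separable_space (euclidean :: 'h topology)"
    and "C0_semigroup S" and "is_generator S D A"
    and "\<psi> \<in> adj_dom D A" and "\<psi> \<noteq> 0" and "adj_op D A \<psi> = lam *\<^sub>R \<psi>"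
    and "inner \<phi> \<psi> \<noteq> 0"
  defines "\<alpha> \<equiv> (- \<rho> + 2 * lam + \<beta>\<^sup>2) / (inner \<phi> \<psi>)\<^sup>2"
  defines "v \<equiv> \<lambda>s x. \<alpha> * exp (- \<rho> * s) * Theta (inner x \<psi>) * (inner x \<psi>)\<^sup>2"
  defines "g \<equiv> \<lambda>x. exp (- \<rho> * T) * \<alpha> * Theta (inner x \<psi>) * (inner x \<psi>)\<^sup>2"
  shows "strong_solution T D A \<beta> (hamiltonian \<rho> \<phi> \<psi>) g v"
proof -
  interpret adjoint_eigenvector D A \<psi> lam
    using assms orthogonal_to_generator_domain[OF assms(3,4)] by unfold_locales blast+
  define \<kappa> where "\<kappa> = - \<rho> + 2 * lam + \<beta>\<^sup>2"
  \<comment> \<open>the constant \<open>\<alpha>\<close> is chosen so that the infimum in the Hamiltonian cancels the value \<open>\<kappa> v\<close> that \<open>L0 v\<close> has off the hyperplane \<open>\<langle>x, \<psi>\<rangle> = 0\<close>\<close>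
  have \<kappa>: "\<alpha> * (inner \<phi> \<psi>)\<^sup>2 = \<kappa>"
    using assms(8) by (simp add: \<alpha>_def \<kappa>_def)
  let ?sq = "\<lambda>y::real. (max 0 y)\<^sup>2"
  have Theta_sq: "Theta y * y\<^sup>2 = ?sq y" for y
    by (simp add: Theta_def max_def)
  have v: "v = profile \<alpha> \<rho> \<psi> ?sq"
    by (simp add: v_def profile_def fun_eq_iff mult.assoc flip: Theta_sq)
  have g: "g = profile \<alpha> \<rho> \<psi> ?sq T"
    by (simp add: g_def profile_def fun_eq_iff mult_ac flip: Theta_sq)
  have dw: "(?sq has_real_derivative 2 * max 0 y) (at y)" for y
    by (rule has_real_derivative_pos_part_compose[where p = "\<lambda>m. m\<^sup>2" and p' = "\<lambda>m. 2 * m"])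
       (auto intro!: derivative_eq_intros)
  have cw: "continuous_on UNIV (\<lambda>y::real. 2 * max 0 y)" "continuous_on UNIV ?sq"
    by (intro continuous_intros)+
  have grad_v: "grad (v s) x = profile \<alpha> \<rho> \<psi> (\<lambda>y. 2 * max 0 y) s x *\<^sub>R \<psi>" for s x
    unfolding v by (rule grad_profile[OF dw])
  define k where "k s x = - profile \<alpha> \<rho> \<psi> (\<lambda>y. \<kappa> * ?sq y) s x" for s x
  have F: "hamiltonian \<rho> \<phi> \<psi> s x (grad (v s) x) = ereal (k s x)" for s x
    by (simp only: grad_v hamiltonian_at_gradient \<kappa> k_def)
  have cont_\<kappa>: "continuous_on UNIV (\<lambda>y. \<kappa> * ?sq y)" by (intro continuous_intros)
  have cont_k: "continuous_on X (\<lambda>(s, x). k s x)" for X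
    using continuous_on_minus[OF continuous_on_profile[OF cont_\<kappa>]] by (simp add: k_def split_def)

  define e where "e n = 1 / real (Suc n)" for n
  have e: "e n > 0" for n by (simp add: e_def)
  have e0: "e \<longlonglongrightarrow> 0"
    unfolding e_def by (rule LIMSEQ_Suc[OF lim_1_over_n])
  let ?f = "\<lambda>n y. smooth_sq (e n) (max 0 y)"
  let ?f' = "\<lambda>n y. smooth_sq' (e n) (max 0 y)"
  let ?f'' = "\<lambda>n y. smooth_sq'' (e n) (max 0 y)"
  define vn where "vn n = profile \<alpha> \<rho> \<psi> (?f n)" for n
  define W where "W n y = - \<rho> * ?f n y + lam * (y * ?f' n y) + 1/2 * \<beta>\<^sup>2 * (y\<^sup>2 * ?f'' n y)" for n y
  \<comment> \<open>the derivatives vanish at \<open>0\<close>, which is the hypothesis for composing with the positive part\<close>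
  have at0: "smooth_sq' (e n) 0 = 0" "smooth_sq'' (e n) 0 = 0" for n
    using e[of n] by (simp_all add: smooth_sq'_def smooth_sq''_def)
  have d0: "(?f n has_real_derivative ?f' n y) (at y)" for n y
    using smooth_sq_deriv(1)[OF e] at0(1) by (rule has_real_derivative_pos_part_compose)
  have d1: "(?f' n has_real_derivative ?f'' n y) (at y)" for n y
    using smooth_sq_deriv(2)[OF e] at0(2) by (rule has_real_derivative_pos_part_compose)
  have c2: "continuous_on UNIV (?f'' n)" for n
    unfolding smooth_sq''_def using e[of n]
    by (intro continuous_intros ballI) (simp add: add_nonneg_eq_0_iff)
  have c0: "continuous_on UNIV (?f n)" for n by (rule DERIV_continuous_on[OF d0])
  have c1: "continuous_on UNIV (?f' n)" for n by (rule DERIV_continuous_on[OF d1])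
  have cW: "continuous_on UNIV (W n)" for n
    unfolding W_def by (intro continuous_intros c0 c1 c2)

  have bound0: "\<bar>?f n y - ?sq y\<bar> \<le> e n * max 0 y" for n y
    by (rule smooth_sq_bound[OF e]) simp
  \<comment> \<open>the error bounds of \<open>smooth_sq\<close>, weighted by the coefficients in \<open>W\<close>\<close>
  define C where "C = \<bar>\<rho>\<bar> + 2 * \<bar>lam\<bar> + \<beta>\<^sup>2"
  have bound: "\<bar>W n y - \<kappa> * ?sq y\<bar> \<le> e n * (C * max 0 y)" for n y
  proof -
    define m where "m = max 0 y"
    have m: "m \<ge> 0" by (simp add: m_def)
    \<comment> \<open>both sides vanish for negative \<open>y\<close>, so \<open>y\<close> may be replaced by its positive part\<close>
    have y: "y * ?f' n y = m * smooth_sq' (e n) m" "y\<^sup>2 * ?f'' n y = m\<^sup>2 * smooth_sq'' (e n) m"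
      by (cases "y \<ge> 0"; simp add: m_def max_def at0)+
    have "W n y - \<kappa> * ?sq y = - \<rho> * (smooth_sq (e n) m - m\<^sup>2)
        + lam * (m * smooth_sq' (e n) m - 2 * m\<^sup>2)
        + 1/2 * \<beta>\<^sup>2 * (m\<^sup>2 * smooth_sq'' (e n) m - 2 * m\<^sup>2)"
      unfolding W_def y \<kappa>_def by (simp add: algebra_simps flip: m_def)
    also have "\<bar>\<dots>\<bar> \<le> \<bar>\<rho>\<bar> * \<bar>smooth_sq (e n) m - m\<^sup>2\<bar>
        + \<bar>lam\<bar> * \<bar>m * smooth_sq' (e n) m - 2 * m\<^sup>2\<bar>
        + 1/2 * \<beta>\<^sup>2 * \<bar>m\<^sup>2 * smooth_sq'' (e n) m - 2 * m\<^sup>2\<bar>"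
      by (intro order_trans[OF abs_triangle_ineq] add_mono) (simp_all add: abs_mult)
    also have "\<dots> \<le> \<bar>\<rho>\<bar> * (e n * m) + \<bar>lam\<bar> * (2 * (e n * m)) + 1/2 * \<beta>\<^sup>2 * (2 * (e n * m))"
      using smooth_sq_bound[OF e m] by (intro add_mono mult_left_mono) auto
    also have "\<dots> = e n * (C * m)" by (simp add: C_def algebra_simps)
    finally show ?thesis by (simp add: m_def)
  qed
  have lim_v: "uniform_limit K (\<lambda>n (s, x). vn n s x) (\<lambda>(s, x). v s x) sequentially"
    if "compact K" for K
    unfolding vn_def v
    by (rule uniform_limit_profile[OF bound0 e0 _ that]) (intro continuous_intros)
  have lim_h: "uniform_limit K (\<lambda>n (s, x). profile \<alpha> \<rho> \<psi> (W n) s x) (\<lambda>(s, x). - k s x) sequentially"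
    if "compact K" for K
    unfolding k_def minus_minus
    by (rule uniform_limit_profile[OF bound e0 _ that]) (intro continuous_intros)
  have lim_g: "uniform_limit K (\<lambda>n. vn n T) g sequentially" if "compact K" for K
  proof -
    have "compact ({T} \<times> K)" using that by (intro compact_Times) auto
    from lim_v[OF this] show ?thesis
      by (simp add: uniform_limit_iff v g)
  qed

  have witness: "\<exists>a b c. P a b c" if "P vn (\<lambda>n. profile \<alpha> \<rho> \<psi> (W n)) (\<lambda>n. vn n T)" for P
    using that by blast
  show ?thesis
    unfolding strong_solution_def
  proof (intro conjI exI[of _ k] witness allI ballI impI)
    show "C01 {0..<T} v" unfolding v by (rule C01_profile[OF dw cw(1)])
    show "continuous_on ({0..T} \<times> UNIV) (\<lambda>(s, x). v s x)"
      unfolding v by (rule continuous_on_profile[OF cw(2)])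
    show "continuous_on UNIV g" "continuous_on UNIV (vn n T)" for n
      unfolding g vn_def profile_def
      by (intro continuous_intros continuous_on_compose2[OF c0]; simp)+
    show "UC_into_adj D A ({0..<T} \<times> UNIV) (\<lambda>(s, x). grad (v s) x)"
      using UC_into_adj_scaleR[OF uniformly_continuous_on_profile[OF cw(1) bounded_ball]]
      by (simp add: grad_v split_def)
    show "\<bar>hamiltonian \<rho> \<phi> \<psi> s x (grad (v s) x)\<bar> \<noteq> \<infinity>"
      "hamiltonian \<rho> \<phi> \<psi> s x (grad (v s) x) = ereal (k s x)" for s x
      by (simp_all add: F)
    show "continuous_on ({0..<T} \<times> UNIV) (\<lambda>(s, x). hamiltonian \<rho> \<phi> \<psi> s x (grad (v s) x))"
      using continuous_on_ereal[OF cont_k] by (simp add: F split_def)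
    show "vn n \<in> dom_L0 T D A" for n
      unfolding vn_def by (rule profile_in_dom_L0[OF assms(1) d0 d1 c2])
    show "L0 T D A \<beta> (vn n) s x = profile \<alpha> \<rho> \<psi> (W n) s x" if "s \<in> {0..T}" for n s x
      unfolding vn_def W_def by (rule L0_profile[OF assms(1) that d0 d1])
    show "continuous_on ({0..T} \<times> UNIV) (\<lambda>(s, x). profile \<alpha> \<rho> \<psi> (W n) s x)" for n
      by (rule continuous_on_profile[OF cW])
  qed (use cont_k lim_v lim_h lim_g in auto)
qed

end
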